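(* For every cache size $k\ge1$, there is a randomized online paging algorithm for the discard-predictions setup that is $(1,2H_k,1)$-competitive, where $H_k=\sum_{j=1}^k 1/j$. That is, there is a constant $b$ (possibly depending on $k$) such that for every request sequence $I$ and every prediction vector $p$, the expected number of page faults satisfies $\mathbb{E}[\mathrm{ALG}(I,p)]\le \mathrm{OPT}(I)+2H_k\,\eta_0(p,p^* )+\eta_1(p,p^* )+b$.
   Context: Paging: there is a universe $U$ of pages and a cache holding at most $k$ pages, initially empty. Requests $r_1,\dots,r_n\in U$ arrive online. If the requested page is not in the cache (a page fault), it must be loaded into the cache, evicting some cached page if the cache already holds $k$ pages. The cost of an algorithm is its number of page faults. An online algorithm decides evictions without knowing future requests; $\mathrm{OPT}(I)$ is the minimum cost of an offline algorithm on request sequence $I$. Along with each request $r_i$ the online algorithm receives a prediction bit $p_i\in\{0,1\}$ (which may be arbitrary). Given the ground truth vector $p^*\in\{0,1\}^n$, define for $h\in\{0,1\}$: $\eta_h(p,p^* )=|\{i\in[n] : p_i=h,\ p_i^*=1-h\}|$. An algorithm is $(\alpha,\beta,\gamma)$-competitive if there is a constant $b$ (possibly depending on $k$) such that for every instance $I$ and all predictions $p$, $\mathrm{ALG}(I,p)\le \alpha\,\mathrm{OPT}(I)+\beta\,\eta_0(p,p^* )+\gamma\,\eta_1(p,p^* )+b$ (for randomized algorithms, $\mathrm{ALG}(I,p)$ is the expected cost). Discard-predictions setup: fix the optimal offline algorithm LFD, which on a fault with full cache evicts a cached page that is never requested again if one exists, and otherwise the cached page whose next request is furthest in the future (ties broken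 by a fixed rule). The ground truth is $p_i^*=0$ if LFD keeps page $r_i$ in its cache until the next request to $r_i$ (or until the end of the sequence if there is no further request), and $p_i^*=1$ if LFD evicts $r_i$ before it is requested again. *)

theory Defs
  imports "HOL-Probability.Probability_Mass_Function"
begin

text \<open>Requests are lists of pages (0-based indices). A cache is a set of pages.
  Predictions are bool lists: True = bit 1 (evict), False = bit 0 (keep).\<close>

definition cur :: "'a set list \<Rightarrow> 'a set" where
  "cur cs = (if cs = [] then {} else last cs)"

text \<open>A randomized online algorithm gets the prefix of (request, prediction) pairs up to and
  including the current one, and the history of its own cache states (the last one is the
  current cache, initially empty), and outputs a distribution over the next cache state.\<close>

type_synonym 'a online_alg = "('a \<times> bool) list \<Rightarrow> 'a set list \<Rightarrow> 'a set pmf"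

definition valid_online_alg :: "nat \<Rightarrow> 'a online_alg \<Rightarrow> bool" where
  "valid_online_alg k A \<longleftrightarrow>
     (\<forall>hs x cs. \<forall>C' \<in> set_pmf (A (hs @ [x]) cs).
        fst x \<in> C' \<and> C' \<subseteq> insert (fst x) (cur cs) \<and> finite C' \<and> card C' \<le> k)"

fun run :: "'a online_alg \<Rightarrow> ('a \<times> bool) list \<Rightarrow> 'a set list \<Rightarrow> ('a \<times> bool) list \<Rightarrow> nat pmf" where
  "run A hs cs [] = return_pmf 0"
| "run A hs cs (x # xs) =
     bind_pmf (A (hs @ [x]) cs)
       (\<lambda>C'. map_pmf (\<lambda>c. c + (if fst x \<in> cur cs then 0 else 1)) (run A (hs @ [x]) (cs @ [C']) xs))"

definition expected_cost :: "'a online_alg \<Rightarrow> 'a list \<Rightarrow> bool list \<Rightarrow> real" where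
  "expected_cost A I p = measure_pmf.expectation (run A [] [] (zip I p)) real"

definition prev_cache :: "'a set list \<Rightarrow> nat \<Rightarrow> 'a set" where
  "prev_cache cs i = (if i = 0 then {} else cs ! (i - 1))"

definition feasible_schedule :: "nat \<Rightarrow> 'a list \<Rightarrow> 'a set list \<Rightarrow> bool" where
  "feasible_schedule k I cs \<longleftrightarrow> length cs = length I \<and>
     (\<forall>i < length I. I ! i \<in> cs ! i \<and> cs ! i \<subseteq> insert (I ! i) (prev_cache cs i)
        \<and> finite (cs ! i) \<and> card (cs ! i) \<le> k)"

definition schedule_cost :: "'a list \<Rightarrow> 'a set list \<Rightarrow> nat" where
  "schedule_cost I cs = card {i. i < length I \<and> I ! i \<notin> prev_cache cs i}"

definition OPT :: "nat \<Rightarrow> 'a list \<Rightarrow> nat" where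
  "OPT k I = (LEAST c. \<exists>cs. feasible_schedule k I cs \<and> schedule_cost I cs = c)"

definition next_req :: "'a list \<Rightarrow> nat \<Rightarrow> 'a \<Rightarrow> nat option" where
  "next_req I i q = (if \<exists>j. i < j \<and> j < length I \<and> I ! j = q
                     then Some (LEAST j. i < j \<and> j < length I \<and> I ! j = q) else None)"

definition lfd_cands :: "'a list \<Rightarrow> nat \<Rightarrow> 'a set \<Rightarrow> 'a set" where
  "lfd_cands I i C =
     (if {q \<in> C. next_req I i q = None} \<noteq> {} then {q \<in> C. next_req I i q = None}
      else {q \<in> C. \<forall>q' \<in> C. the (next_req I i q') \<le> the (next_req I i q)})"

definition lfd_step :: "('a set \<Rightarrow> 'a) \<Rightarrow> nat \<Rightarrow> 'a list \<Rightarrow> nat \<Rightarrow> 'a set \<Rightarrow> 'a set" where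
  "lfd_step tb k I i C =
     (let r = I ! i in
      if r \<in> C then C
      else if card C < k then insert r C
      else insert r (C - {tb (lfd_cands I i C)}))"

fun lfd_before :: "('a set \<Rightarrow> 'a) \<Rightarrow> nat \<Rightarrow> 'a list \<Rightarrow> nat \<Rightarrow> 'a set" where
  "lfd_before tb k I 0 = {}"
| "lfd_before tb k I (Suc i) = lfd_step tb k I i (lfd_before tb k I i)"

text \<open>Ground truth bit p*_i (True = 1): LFD evicts r_i before its next request
  (or before the end of the sequence if there is none).\<close>
definition truth :: "('a set \<Rightarrow> 'a) \<Rightarrow> nat \<Rightarrow> 'a list \<Rightarrow> nat \<Rightarrow> bool" where
  "truth tb k I i =
     (let m = (case next_req I i (I ! i) of Some j \<Rightarrow> j | None \<Rightarrow> length I) in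
      \<exists>j. i < j \<and> j \<le> m \<and> I ! i \<notin> lfd_before tb k I j)"

definition eta0 :: "('a set \<Rightarrow> 'a) \<Rightarrow> nat \<Rightarrow> 'a list \<Rightarrow> bool list \<Rightarrow> nat" where
  "eta0 tb k I p = card {i. i < length I \<and> \<not> p ! i \<and> truth tb k I i}"

definition eta1 :: "('a set \<Rightarrow> 'a) \<Rightarrow> nat \<Rightarrow> 'a list \<Rightarrow> bool list \<Rightarrow> nat" where
  "eta1 tb k I p = card {i. i < length I \<and> p ! i \<and> \<not> truth tb k I i}"

end

theory Submission
  imports Defs
begin

text \<open>The algorithm is a marking algorithm that prefers to evict pages with prediction 1.
  Call a page whose latest prediction is 0 a 0-page. A phase starts when a fault meets a cache full
  of 0-pages requested in the phase just ending; they become unmarked. On a fault, a page with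
  prediction 1 is evicted if one is cached, and otherwise a uniformly random unmarked page.

  A fault on a page whose latest prediction is 1 is a fault of LFD or charged to a wrong
  prediction 1, and LFD is optimal. If \<open>c\<close> evictions in a phase hit unmarked pages because no page
  with prediction 1 was cached, the usual analysis of marking bounds the expected number of faults on
  the unmarked pages by \<open>c H\<^sub>k\<close>, including the later faults on the unmarked pages that are dropped at
  the end of the phase. At the last such eviction there are at least \<open>k + c\<close> pages consisting of the
  request and of 0-pages whose latest request was in this phase or the previous one. As LFD holds only
  \<open>k\<close> of them, at least \<open>c\<close> of these predictions 0 were wrong. Each wrong prediction is counted in
  at most two phases, which gives the factor \<open>2 H\<^sub>k\<close>.\<close>

section \<open>Uniformly random subsets\<close>

definition usets :: "'a set \<Rightarrow> nat \<Rightarrow> 'a set set" where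
  "usets U u = {R. R \<subseteq> U \<and> card R = u}"

lemma finite_usets: "finite U \<Longrightarrow> finite (usets U u)"
  by (auto simp: usets_def intro: finite_subset[of _ "Pow U"])

lemma card_usets: "finite U \<Longrightarrow> card (usets U u) = card U choose u"
  by (simp add: usets_def n_subsets)

lemma usets_nonempty: "u \<le> card U \<Longrightarrow> usets U u \<noteq> {}"
  unfolding usets_def using obtain_subset_with_card_n[of u U] by blast

lemma usets_0: "finite U \<Longrightarrow> usets U 0 = {{}}"
  by (auto simp: usets_def dest: finite_subset)

lemma usets_card: "finite U \<Longrightarrow> usets U (card U) = {U}"
  by (auto simp: usets_def dest: card_subset_eq)

text \<open>Such a superset is determined by the one element it adds to \<open>T\<close>. This turns
  both pmf computations below into sums over single pages.\<close>

lemma sum_usets_supersets: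
  fixes g :: "'a set \<Rightarrow> real"
  assumes U: "finite U" and T: "T \<in> usets U u"
  shows "(\<Sum>R\<in>{R\<in>usets U (Suc u). T \<subseteq> R}. g R) = (\<Sum>x\<in>U - T. g (insert x T))"
proof -
  have fT: "finite T" "T \<subseteq> U" "card T = u" using T U finite_subset by (auto simp: usets_def)
  have "{R\<in>usets U (Suc u). T \<subseteq> R} = (\<lambda>x. insert x T) ` (U - T)"
  proof (intro equalityI subsetI)
    fix R assume R: "R \<in> {R\<in>usets U (Suc u). T \<subseteq> R}"
    then have "card (R - T) = 1" using fT
      by (auto simp: usets_def card_Diff_subset)
    then obtain x where "R - T = {x}" using card_1_singletonE by blast
    then have "R = insert x T" "x \<in> U - T" using R by (auto simp: usets_def)
    then show "R \<in> (\<lambda>x. insert x T) ` (U - T)" by blast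
  qed (use fT in \<open>auto simp: usets_def\<close>)
  moreover have "inj_on (\<lambda>x. insert x T) (U - T)" by (auto simp: inj_on_def)
  ultimately show ?thesis by (simp add: sum.reindex)
qed

lemma Suc_times_binomial_complement:
  "Suc u \<le> n \<Longrightarrow> Suc u * (n choose Suc u) = (n - u) * (n choose u)"
  by (metis Suc_times_binomial_eq binomial_absorb_comp binomial_absorption mult.commute)

text \<open>Double counting: a \<open>u\<close>-set lies in \<open>card U - u\<close> sets of size
  \<open>Suc u\<close>, and each of them yields it with probability \<open>1 / Suc u\<close>. This
  models the eviction of a random unmarked page.\<close>

lemma bind_usets_drop:
  assumes U: "finite U" and u: "Suc u \<le> card U"
  shows "bind_pmf (pmf_of_set (usets U (Suc u))) (\<lambda>R. pmf_of_set (usets R u)) = pmf_of_set (usets U u)"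
proof (rule pmf_eqI)
  fix T
  let ?S = "usets U (Suc u)"
  have S: "finite ?S" "?S \<noteq> {}" using U u by (auto simp: finite_usets usets_nonempty)
  have V: "finite (usets U u)" "usets U u \<noteq> {}" using U u by (auto simp: finite_usets usets_nonempty)
  have R: "finite R" "card R = Suc u" "R \<subseteq> U" if "R \<in> ?S" for R
    using that U finite_subset by (auto simp: usets_def)
  have pR: "pmf (pmf_of_set (usets R u)) T = (if T \<in> usets R u then 1 / Suc u else 0)" if "R \<in> ?S" for R
    using R[OF that] by (auto simp: finite_usets usets_nonempty card_usets)
  have "pmf (bind_pmf (pmf_of_set ?S) (\<lambda>R. pmf_of_set (usets R u))) T
      = (\<Sum>R\<in>?S. pmf (pmf_of_set (usets R u)) T) / card ?S"
    using S by (rule pmf_bind_pmf_of_set[rotated])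
  also have "(\<Sum>R\<in>?S. pmf (pmf_of_set (usets R u)) T) = (\<Sum>R\<in>?S. if T \<in> usets R u then 1 / Suc u else 0)"
    using pR by (intro sum.cong) auto
  also have "\<dots> = (if T \<in> usets U u then (\<Sum>R\<in>{R\<in>?S. T \<subseteq> R}. 1 / Suc u) else 0)"
  proof (cases "T \<in> usets U u")
    case True
    then show ?thesis using S(1)
      by (simp add: sum.inter_filter[symmetric] usets_def conj_commute)
  next
    case False
    then have "T \<notin> usets R u" if "R \<in> ?S" for R using R[OF that] by (auto simp: usets_def)
    then show ?thesis using False by simp
  qed
  also have "\<dots> = (if T \<in> usets U u then (card U - u) / Suc u else 0)"
  proof -
    have "card (U - T) = card U - u" if "T \<in> usets U u"
      using that U by (auto simp: usets_def card_Diff_subset finite_subset)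
    then show ?thesis using sum_usets_supersets[OF U, of T u "\<lambda>_. 1 / Suc u"] by auto
  qed
  also have "\<dots> / card ?S = pmf (pmf_of_set (usets U u)) T"
  proof -
    have "real (Suc u) * (card U choose Suc u) = real (card U - u) * (card U choose u)"
      using Suc_times_binomial_complement[OF u] by (metis of_nat_mult)
    moreover have "card U choose Suc u > 0" "card U choose u > 0" using u by auto
    ultimately show ?thesis using V U by (simp add: card_usets indicator_def field_simps)
  qed
  finally show "pmf (bind_pmf (pmf_of_set ?S) (\<lambda>R. pmf_of_set (usets R u))) T = pmf (pmf_of_set (usets U u)) T" .
qed

text \<open>If \<open>r\<close> is in \<open>R\<close>, the second draw is forced; otherwise a
  random member gives way to \<open>r\<close>. A fixed \<open>T\<close> gets weight 1 from
  \<open>insert r T\<close> and \<open>1 / Suc u\<close> from each of the other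
  \<open>card U - u - 1\<close> supersets, in total \<open>card U / Suc u\<close> whatever
  \<open>T\<close> is.\<close>

lemma bind_usets_remove:
  assumes U: "finite U" and r: "r \<in> U" and u: "Suc u \<le> card U"
  shows "bind_pmf (pmf_of_set (usets U (Suc u))) (\<lambda>R. pmf_of_set (usets (R - {r}) u))
    = pmf_of_set (usets (U - {r}) u)"
proof (rule pmf_eqI)
  fix T
  let ?S = "usets U (Suc u)" and ?V = "usets (U - {r}) u"
  let ?g = "\<lambda>R. if r \<in> R then 1 else 1 / real (Suc u)"
  have S: "finite ?S" "?S \<noteq> {}" using U u by (auto simp: finite_usets usets_nonempty)
  have V: "finite ?V" "?V \<noteq> {}" using U u r by (auto simp: finite_usets intro!: usets_nonempty)
  have R: "finite R" "card R = Suc u" "R \<subseteq> U" if "R \<in> ?S" for R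
    using that U finite_subset by (auto simp: usets_def)
  have pR: "pmf (pmf_of_set (usets (R - {r}) u)) T = (if T \<in> usets (R - {r}) u then ?g R else 0)"
    if "R \<in> ?S" for R
  proof (cases "r \<in> R")
    case True
    then have c: "card (R - {r}) = u" using R[OF that] by simp
    then have "usets (R - {r}) u = {R - {r}}" using R[OF that] usets_card[of "R - {r}"] by simp
    then show ?thesis using True by (simp add: indicator_def)
  next
    case False
    then show ?thesis using R[OF that] by (auto simp: finite_usets usets_nonempty card_usets)
  qed
  have "pmf (bind_pmf (pmf_of_set ?S) (\<lambda>R. pmf_of_set (usets (R - {r}) u))) T
      = (\<Sum>R\<in>?S. pmf (pmf_of_set (usets (R - {r}) u)) T) / card ?S"
    using S by (rule pmf_bind_pmf_of_set[rotated])
  also have "(\<Sum>R\<in>?S. pmf (pmf_of_set (usets (R - {r}) u)) T)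
      = (\<Sum>R\<in>?S. if T \<in> usets (R - {r}) u then ?g R else 0)"
    using pR by (intro sum.cong) auto
  also have "\<dots> = (if T \<in> ?V then (\<Sum>R\<in>{R\<in>?S. T \<subseteq> R}. ?g R) else 0)"
  proof (cases "T \<in> ?V")
    case True
    have "T \<in> usets (R - {r}) u \<longleftrightarrow> T \<subseteq> R" for R using True by (auto simp: usets_def)
    then show ?thesis using S(1) True
      by (simp add: sum.inter_filter[symmetric])
  next
    case False
    then have "T \<notin> usets (R - {r}) u" if "R \<in> ?S" for R using R[OF that] by (auto simp: usets_def)
    then show ?thesis using False by simp
  qed
  also have "\<dots> = (if T \<in> ?V then card U / Suc u else 0)"
  proof (cases "T \<in> ?V")
    case True
    then have T: "T \<in> usets U u" "r \<notin> T" by (auto simp: usets_def)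
    have cT: "card (U - T - {r}) = card U - u - 1"
      using T U r finite_subset[of T U] by (simp add: usets_def card_Diff_subset)
    have "(\<Sum>R\<in>{R\<in>?S. T \<subseteq> R}. ?g R) = (\<Sum>x\<in>U - T. ?g (insert x T))"
      using U T(1) by (rule sum_usets_supersets)
    also have "\<dots> = ?g (insert r T) + (\<Sum>x\<in>U - T - {r}. ?g (insert x T))"
      using T r U by (intro sum.remove) auto
    also have "(\<Sum>x\<in>U - T - {r}. ?g (insert x T)) = (\<Sum>x\<in>U - T - {r}. 1 / Suc u)"
      using T by (intro sum.cong) auto
    also have "\<dots> = real (card U - u - 1) / Suc u" using cT by simp
    also have "?g (insert r T) + real (card U - u - 1) / Suc u = card U / Suc u"
      using u by (simp add: field_simps of_nat_diff)
    finally show ?thesis using True by simp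
  qed auto
  also have "\<dots> / card ?S = pmf (pmf_of_set ?V) T"
  proof -
    have "Suc u * (card U choose Suc u) = card U * ((card U - 1) choose u)"
      by (rule binomial_absorption)
    then have "real (Suc u) * (card U choose Suc u) = real (card U) * ((card U - 1) choose u)"
      by (metis of_nat_mult)
    moreover have "card U choose Suc u > 0" "(card U - 1) choose u > 0" using u by auto
    ultimately show ?thesis using V U r by (simp add: card_usets indicator_def field_simps)
  qed
  finally show "pmf (bind_pmf (pmf_of_set ?S) (\<lambda>R. pmf_of_set (usets (R - {r}) u))) T = pmf (pmf_of_set ?V) T" .
qed

lemma expectation_bind_finite:
  fixes h :: "'b \<Rightarrow> real"
  assumes "finite (set_pmf p)" "\<And>x. x \<in> set_pmf p \<Longrightarrow> finite (set_pmf (f x))"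
  shows "measure_pmf.expectation (bind_pmf p f) h
    = measure_pmf.expectation p (\<lambda>a. measure_pmf.expectation (f a) h)"
  using assms
  by (subst pmf_expectation_bind[of "set_pmf p"])
     (auto simp: integral_measure_pmf[of "set_pmf p"])

section \<open>Optimality of LFD\<close>

definition faults_before :: "'a list \<Rightarrow> (nat \<Rightarrow> 'a set) \<Rightarrow> nat \<Rightarrow> nat" where
  "faults_before I c t = card {i. i < t \<and> I ! i \<notin> c i}"

lemma faults_before_0 [simp]: "faults_before I c 0 = 0"
  by (simp add: faults_before_def)

lemma faults_before_Suc [simp]:
  "faults_before I c (Suc t) = faults_before I c t + (if I ! t \<notin> c t then 1 else 0)"
proof -
  have "{i. i < Suc t \<and> I ! i \<notin> c i} = {i. i < t \<and> I ! i \<notin> c i} \<union> (if I ! t \<notin> c t then {t} else {})"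
    by (auto simp: less_Suc_eq)
  then show ?thesis by (auto simp: faults_before_def)
qed

definition due :: "'a list \<Rightarrow> nat \<Rightarrow> nat \<Rightarrow> 'a set" where
  "due I t \<tau> = {q. \<exists>j. t \<le> j \<and> j \<le> \<tau> \<and> I ! j = q}"

lemma next_req_SomeI:
  assumes "i < j" "j < length I" "I ! j = q"
  obtains m where "next_req I i q = Some m" "i < m" "m \<le> j" "I ! m = q"
proof -
  let ?P = "\<lambda>j. i < j \<and> j < length I \<and> I ! j = q"
  have "?P j" using assms by simp
  then have "next_req I i q = Some (LEAST j. ?P j)" "?P (LEAST j. ?P j)" "(LEAST j. ?P j) \<le> j"
    using LeastI[of ?P j] Least_le[of ?P j] unfolding next_req_def by (auto simp: next_req_def)
  then show ?thesis using that by blast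
qed

lemma next_req_SomeD:
  assumes "next_req I i q = Some m"
  shows "i < m \<and> m < length I \<and> I ! m = q"
proof -
  let ?P = "\<lambda>j. i < j \<and> j < length I \<and> I ! j = q"
  have "\<exists>j. ?P j" "m = (LEAST j. ?P j)" using assms by (auto simp: next_req_def split: if_splits)
  then show ?thesis using LeastI_ex[of ?P] by simp
qed

lemma lfd_cands_subset: "lfd_cands I i C \<subseteq> C"
  by (auto simp: lfd_cands_def)

lemma lfd_cands_nonempty:
  assumes "finite C" "C \<noteq> {}"
  shows "lfd_cands I i C \<noteq> {}"
proof (cases "{q \<in> C. next_req I i q = None} = {}")
  case True
  let ?f = "\<lambda>q. the (next_req I i q)"
  have "Max (?f ` C) \<in> ?f ` C" using assms by (intro Max_in) auto
  then obtain q where "q \<in> C" "?f q = Max (?f ` C)" by auto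
  then have "q \<in> lfd_cands I i C" using True assms by (auto simp: lfd_cands_def)
  then show ?thesis by blast
qed (auto simp: lfd_cands_def)

text \<open>The victim has the furthest next request, so its deadline bounds those of all cached
  pages. Thus LFD gives up a due page only when its whole cache is due.\<close>

lemma lfd_cands_furthest:
  assumes v: "v \<in> lfd_cands I i C" and due: "v \<in> due I (Suc i) \<tau>" and \<tau>: "\<tau> < length I"
  shows "C \<subseteq> due I (Suc i) \<tau>"
proof
  fix q assume q: "q \<in> C"
  from due obtain j where "Suc i \<le> j" "j \<le> \<tau>" "I ! j = v" by (auto simp: due_def)
  then obtain m where m: "next_req I i v = Some m" "m \<le> j"
    using next_req_SomeI[of i j I v] \<tau> by (metis Suc_le_lessD le_less_trans)
  then have "{q \<in> C. next_req I i q = None} = {}" and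
     mx: "\<forall>q'\<in>C. the (next_req I i q') \<le> the (next_req I i v)"
    using v by (auto simp: lfd_cands_def split: if_splits)
  then obtain m' where "next_req I i q = Some m'" using q by fastforce
  then have "Suc i \<le> m'" "m' \<le> \<tau>" "I ! m' = q"
    using next_req_SomeD[of I i q m'] mx q m \<open>j \<le> \<tau>\<close> by fastforce+
  then show "q \<in> due I (Suc i) \<tau>" by (auto simp: due_def)
qed

locale lfd =
  fixes tb :: "'a set \<Rightarrow> 'a" and k :: nat and I :: "'a list"
  assumes tie_rule: "S \<noteq> {} \<Longrightarrow> tb S \<in> S" and k_pos: "k \<ge> 1"
begin

abbreviation L :: "nat \<Rightarrow> 'a set" where "L \<equiv> lfd_before tb k I"

declare lfd_before.simps(2) [simp del]

lemma L_step_cases: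
  obtains (hit) "I ! t \<in> L t" "L (Suc t) = L t"
  | (insert) "I ! t \<notin> L t" "card (L t) < k" "L (Suc t) = insert (I ! t) (L t)"
  | (evict) v where "I ! t \<notin> L t" "card (L t) \<ge> k" "v = tb (lfd_cands I t (L t))"
      "L (Suc t) = insert (I ! t) (L t - {v})"
proof -
  have "L (Suc t) = (if I ! t \<in> L t then L t else if card (L t) < k then insert (I ! t) (L t)
      else insert (I ! t) (L t - {tb (lfd_cands I t (L t))}))"
    by (simp add: lfd_before.simps(2) lfd_step_def Let_def)
  then show thesis using that by (metis linorder_not_less)
qed

lemma tb_cands:
  assumes "finite C" "card C \<ge> k"
  shows "tb (lfd_cands I t C) \<in> lfd_cands I t C"
  using assms k_pos by (intro tie_rule lfd_cands_nonempty) auto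

lemma L_finite_card: "finite (L t) \<and> card (L t) \<le> k"
proof (induction t)
  case (Suc t)
  show ?case
  proof (cases rule: L_step_cases[of t])
    case (evict v)
    then have "v \<in> lfd_cands I t (L t)" using tb_cands[of "L t" t] Suc by simp
    then have "v \<in> L t" using lfd_cands_subset[of I t "L t"] by (rule set_mp[rotated])
    then show ?thesis using Suc evict k_pos by (auto simp: card_insert_if)
  qed (use Suc in \<open>auto simp: card_insert_if\<close>)
qed simp

lemma L_requested: "I ! t \<in> L (Suc t)"
  by (cases rule: L_step_cases[of t]) auto

lemma L_mono_notin: "q \<notin> L t \<Longrightarrow> q \<noteq> I ! t \<Longrightarrow> q \<notin> L (Suc t)"
  by (cases rule: L_step_cases[of t]) auto

text \<open>The invariant compares, for every deadline, how many pages each cache holds that are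
  requested again by that deadline; LFD can only trail by as many as it has saved faults.\<close>

lemma lfd_invariant:
  assumes cs: "feasible_schedule k I cs" and t: "t \<le> length I"
  shows "faults_before I L t \<le> faults_before I (prev_cache cs) t \<and>
    (\<forall>\<tau>. t \<le> \<tau> \<and> \<tau> < length I \<longrightarrow>
       faults_before I L t + card (prev_cache cs t \<inter> due I t \<tau>)
         \<le> faults_before I (prev_cache cs) t + card (L t \<inter> due I t \<tau>))"
  using t
proof (induction t)
  case 0
  then show ?case by (simp add: prev_cache_def)
next
  case (Suc t)
  let ?S = "prev_cache cs" and ?r = "I ! t"
  let ?cL = "faults_before I L" and ?cS = "faults_before I (prev_cache cs)"
  from Suc have tn: "t < length I" and J1: "?cL t \<le> ?cS t"
    and J2: "\<And>\<tau>. t \<le> \<tau> \<Longrightarrow> \<tau> < length I \<Longrightarrow>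
       ?cL t + card (?S t \<inter> due I t \<tau>) \<le> ?cS t + card (L t \<inter> due I t \<tau>)" by auto
  have S': "?S (Suc t) = cs ! t" by (simp add: prev_cache_def)
  have feas: "?r \<in> ?S (Suc t)" "?S (Suc t) \<subseteq> insert ?r (?S t)" "finite (?S (Suc t))"
      "card (?S (Suc t)) \<le> k"
    unfolding S' using cs tn by (auto simp: feasible_schedule_def)
  have finS: "finite (?S t)"
    using cs tn by (auto simp: feasible_schedule_def prev_cache_def)
  have finL: "finite (L t)" "card (L t) \<le> k" using L_finite_card by auto
  have due_t: "due I t t = {?r}" by (auto simp: due_def dest: le_antisym)
  \<comment> \<open>With deadline \<open>t\<close> only the requested page is due, so a fault of LFD
    on a hit of the schedule presupposes a fault saved earlier.\<close>
  have J0: "?cL t + 1 \<le> ?cS t" if "?r \<notin> L t" "?r \<in> ?S t"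
    using J2[of t] tn that by (simp add: due_t)
  have 1: "?cL (Suc t) \<le> ?cS (Suc t)" using J0 J1 by auto
  have 2: "?cL (Suc t) + card (?S (Suc t) \<inter> due I (Suc t) \<tau>)
       \<le> ?cS (Suc t) + card (L (Suc t) \<inter> due I (Suc t) \<tau>)"
    if \<tau>: "Suc t \<le> \<tau>" "\<tau> < length I" for \<tau>
  proof -
    let ?D = "due I (Suc t) \<tau>"
    \<comment> \<open>Both new caches hold the requested page, so its contribution
      \<open>\<rho>\<close> cancels and only the other pages need comparing.\<close>
    define \<rho> :: nat where "\<rho> = (if ?r \<in> ?D then 1 else 0)"
    have D: "due I t \<tau> = insert ?r ?D"
    proof -
      have "t \<le> j \<longleftrightarrow> j = t \<or> Suc t \<le> j" for j by auto
      then show ?thesis using \<tau> by (auto simp: due_def)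
    qed
    have split: "card (X \<inter> ?D) = card ((X - {?r}) \<inter> ?D) + (if ?r \<in> X then \<rho> else 0)"
      if "finite X" for X
    proof (cases "?r \<in> X \<inter> ?D")
      case True
      then have "X \<inter> ?D = insert ?r ((X - {?r}) \<inter> ?D)" by auto
      then have "card (X \<inter> ?D) = Suc (card ((X - {?r}) \<inter> ?D))" using that
        by (metis Diff_iff Int_iff card_insert_disjoint finite_Diff finite_Int insertI1)
      then show ?thesis using True by (simp add: \<rho>_def)
    next
      case False
      then have "X \<inter> ?D = (X - {?r}) \<inter> ?D" by auto
      then show ?thesis using False by (auto simp: \<rho>_def)
    qed
    have split0: "card (X \<inter> due I t \<tau>) = card ((X - {?r}) \<inter> ?D) + (if ?r \<in> X then 1 else 0)"
      if "finite X" for X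
    proof (cases "?r \<in> X")
      case True
      then have "X \<inter> due I t \<tau> = insert ?r ((X - {?r}) \<inter> ?D)" unfolding D by auto
      then show ?thesis using that True by simp
    next
      case False
      then have "X \<inter> due I t \<tau> = (X - {?r}) \<inter> ?D" unfolding D by auto
      then show ?thesis using False by simp
    qed
    have old: "?cL t + (card ((?S t - {?r}) \<inter> ?D) + (if ?r \<in> ?S t then 1 else 0))
        \<le> ?cS t + (card ((L t - {?r}) \<inter> ?D) + (if ?r \<in> L t then 1 else 0))"
      using J2[of \<tau>] \<tau> split0[OF finS] split0[OF finL(1)] by simp
    have newS: "card (?S (Suc t) \<inter> ?D) = card ((?S (Suc t) - {?r}) \<inter> ?D) + \<rho>"
      using split[OF feas(3)] feas(1) by simp
    have leS: "card ((?S (Suc t) - {?r}) \<inter> ?D) \<le> card ((?S t - {?r}) \<inter> ?D)"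
      using feas finS by (intro card_mono) auto
    have newL: "card (L (Suc t) \<inter> ?D) = card ((L (Suc t) - {?r}) \<inter> ?D) + \<rho>"
      using split[of "L (Suc t)"] L_finite_card L_requested by simp
    show ?thesis
    proof (cases "(L (Suc t) - {?r}) \<inter> ?D = (L t - {?r}) \<inter> ?D")
      case True
      then show ?thesis using old newS leS newL by (auto split: if_splits)
    next
      case False
      then obtain v where v: "?r \<notin> L t" "card (L t) \<ge> k" "v = tb (lfd_cands I t (L t))"
        "L (Suc t) = insert ?r (L t - {v})"
        by (cases rule: L_step_cases[of t]) auto
      have vc: "v \<in> lfd_cands I t (L t)" using v(2,3) tb_cands[of "L t" t] finL(1) by simp
      then have vL: "v \<in> L t" using lfd_cands_subset[of I t "L t"] by (rule set_mp[rotated])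
      have "v \<in> ?D" using False v by auto
      \<comment> \<open>LFD now keeps \<open>k - 1\<close> due pages besides the request. No
        schedule can hold more, so the comparison of faults in \<open>1\<close> suffices.\<close>
      then have sub: "L t \<subseteq> ?D" using lfd_cands_furthest[OF vc] \<tau> by simp
      have "(L (Suc t) - {?r}) \<inter> ?D = L t - {v}" using v sub by auto
      then have "card ((L (Suc t) - {?r}) \<inter> ?D) = k - 1" using v vL finL by simp
      moreover have "card ((?S (Suc t) - {?r}) \<inter> ?D) \<le> card (?S (Suc t) - {?r})"
        using feas by (intro card_mono) auto
      moreover have "card (?S (Suc t) - {?r}) \<le> k - 1" using feas by simp
      ultimately show ?thesis using newL newS 1 by linarith
    qed
  qed
  show ?case using 1 2 by blast
qed

lemma lfd_le_OPT: "faults_before I L (length I) \<le> OPT k I"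
proof -
  \<comment> \<open>Some feasible schedule is needed for the \<open>LEAST\<close> in
    \<open>OPT\<close> to be attained.\<close>
  have "feasible_schedule k I (map (\<lambda>x. {x}) I)"
    using k_pos by (auto simp: feasible_schedule_def)
  then have "\<exists>c cs. feasible_schedule k I cs \<and> schedule_cost I cs = c" by blast
  then have "\<exists>cs. feasible_schedule k I cs \<and> schedule_cost I cs = OPT k I"
    unfolding OPT_def by (rule LeastI_ex)
  then obtain cs where cs: "feasible_schedule k I cs" "schedule_cost I cs = OPT k I" by blast
  have "faults_before I (prev_cache cs) (length I) = schedule_cost I cs"
    by (simp add: faults_before_def schedule_cost_def)
  then show ?thesis using lfd_invariant[OF cs(1), of "length I"] cs(2) by simp
qed

end

section \<open>The marking algorithm and its expected cost\<close>

text \<open>A state \<open>(M, N, U, u)\<close>: the pages requested in the current phase whose latest prediction is 0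
  (\<open>M\<close>), the cached pages whose latest prediction is 1 (\<open>N\<close>), the not yet requested pages
  that filled the cache when the phase began (\<open>U\<close>), and how many pages of \<open>U\<close> are still
  cached (\<open>u\<close>). The state depends on requests and predictions only; the random part of the cache
  is a uniformly distributed \<open>u\<close>-subset of \<open>U\<close>. To keep \<open>u\<close> deterministic, a request
  to a page of \<open>U\<close> always uses up one of the \<open>u\<close> places, even on a fault while \<open>N\<close> is
  nonempty. Once \<open>u = 0\<close>, the uncached pages \<open>U\<close> are forgotten.\<close>

type_synonym 'a mark_state = "'a set \<times> 'a set \<times> 'a set \<times> nat"

text \<open>A hit also takes the page out, because \<open>admit\<close> files it again under its new
  prediction. In the last branch the \<open>k\<close> pages of \<open>M\<close> become the unmarked
  ones with \<open>k - 1\<close> places, so a uniformly random one of them is evicted.\<close>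

fun make_room :: "nat \<Rightarrow> 'a mark_state \<Rightarrow> 'a \<Rightarrow> 'a mark_state" where
  "make_room k (M, N, U, u) r =
     (if r \<in> M \<union> N then (M - {r}, N - {r}, U, u)
      else if r \<in> U then (M, N, U - {r}, u - 1)
      else if card M + card N + u < k then (M, N, U, u)
      else if N \<noteq> {} then (M, N - {SOME q. q \<in> N}, U, u)
      else if 0 < u then (M, N, U, u - 1)
      else ({}, {}, M, k - 1))"

fun admit :: "'a mark_state \<Rightarrow> 'a \<times> bool \<Rightarrow> 'a mark_state" where
  "admit (M, N, U, u) (r, b) =
     (if b then M else insert r M, if b then insert r N else N, if u = 0 then {} else U, u)"

definition mark_step :: "nat \<Rightarrow> 'a mark_state \<Rightarrow> 'a \<times> bool \<Rightarrow> 'a mark_state" where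
  "mark_step k st x = admit (make_room k st (fst x)) x"

definition mark_state :: "nat \<Rightarrow> ('a \<times> bool) list \<Rightarrow> 'a mark_state" where
  "mark_state k hs = foldl (mark_step k) ({}, {}, {}, 0) hs"

lemma mark_state_Nil [simp]: "mark_state k [] = ({}, {}, {}, 0)"
  by (simp add: mark_state_def)

lemma mark_state_snoc [simp]: "mark_state k (hs @ [x]) = mark_step k (mark_state k hs) x"
  by (simp add: mark_state_def)

fun mark_inv :: "nat \<Rightarrow> 'a mark_state \<Rightarrow> bool" where
  "mark_inv k (M, N, U, u) \<longleftrightarrow>
     finite M \<and> finite N \<and> finite U \<and> M \<inter> N = {} \<and> (M \<union> N) \<inter> U = {} \<and>
     card M + card N + u \<le> k \<and> u \<le> card U \<and> card U \<le> k \<and> (u = 0 \<longrightarrow> U = {})"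

lemma make_room_cases:
  assumes inv: "mark_inv k (M, N, U, u)"
  obtains
    (hit) "r \<in> M \<union> N" "make_room k (M, N, U, u) r = (M - {r}, N - {r}, U, u)"
  | (unmarked) v where "r \<in> U" "r \<notin> M \<union> N" "u = Suc v" "make_room k (M, N, U, u) r = (M, N, U - {r}, v)"
  | (room) "r \<notin> M \<union> N \<union> U" "card M + card N + u < k" "make_room k (M, N, U, u) r = (M, N, U, u)"
  | (discard) q where "r \<notin> M \<union> N \<union> U" "q \<in> N" "make_room k (M, N, U, u) r = (M, N - {q}, U, u)"
  | (stale) v where "r \<notin> M \<union> N \<union> U" "N = {}" "u = Suc v" "card M + u = k"
      "make_room k (M, N, U, u) r = (M, N, U, v)"
  | (phase) "r \<notin> M \<union> N \<union> U" "N = {}" "u = 0" "U = {}" "card M = k"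
      "make_room k (M, N, U, u) r = ({}, {}, M, k - 1)"
proof -
  consider "r \<in> M \<union> N" | "r \<notin> M \<union> N" "r \<in> U" | "r \<notin> M \<union> N \<union> U" by blast
  then show thesis
  proof cases
    case 1
    then show ?thesis using hit by simp
  next
    case 2
    then obtain v where "u = Suc v" using inv by (cases u) auto
    then show ?thesis using 2 unmarked by simp
  next
    case 3
    consider "card M + card N + u < k" | "card M + card N + u = k" "N \<noteq> {}"
      | "card M + card N + u = k" "N = {}" "u > 0" | "card M + card N + u = k" "N = {}" "u = 0"
      using inv by fastforce
    then show ?thesis
    proof cases
      case a: 1
      then show ?thesis using 3 room by simp
    next
      case a: 2
      then have "(SOME q. q \<in> N) \<in> N" by (simp add: some_in_eq)
      then show ?thesis using 3 a discard by simp
    next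
      case a: 3
      then obtain v where "u = Suc v" by (cases u) auto
      then show ?thesis using 3 a stale by simp
    next
      case a: 4
      then show ?thesis using 3 inv phase by simp
    qed
  qed
qed

lemma mark_inv_admit:
  assumes "finite M" "finite N" "finite U" "M \<inter> N = {}" "(M \<union> N) \<inter> U = {}" "r \<notin> M \<union> N \<union> U"
    "card M + card N + u < k" "u \<le> card U" "card U \<le> k"
  shows "mark_inv k (admit (M, N, U, u) (r, b))"
  using assms by auto

lemma mark_inv_step:
  assumes inv: "mark_inv k st" and k: "k \<ge> 1"
  shows "mark_inv k (mark_step k st x)"
proof -
  obtain M N U u r b where st: "st = (M, N, U, u)" and x: "x = (r, b)"
    by (metis prod_cases4 surj_pair)
  have I: "finite M" "finite N" "finite U" "M \<inter> N = {}" "(M \<union> N) \<inter> U = {}"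
     "card M + card N + u \<le> k" "u \<le> card U" "card U \<le> k" "u = 0 \<Longrightarrow> U = {}"
    using inv by (auto simp: st)
  have inv': "mark_inv k (M, N, U, u)" using inv by (simp only: st)
  then show ?thesis unfolding st x mark_step_def fst_conv
  proof (cases rule: make_room_cases[where r = r])
    case hit
    have "card (M - {r}) + card (N - {r}) < card M + card N"
    proof -
      have "card (M - {r}) < card M \<or> card (N - {r}) < card N"
        using hit(1) I(1,2) by (meson Un_iff card_Diff1_less)
      moreover have "card (M - {r}) \<le> card M" "card (N - {r}) \<le> card N"
        by (rule card_Diff1_le)+
      ultimately show ?thesis by linarith
    qed
    then show "mark_inv k (admit (make_room k (M, N, U, u) r) (r, b))"
      unfolding hit(2) using hit(1) I by (intro mark_inv_admit) auto
  next
    case (unmarked v)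
    show "mark_inv k (admit (make_room k (M, N, U, u) r) (r, b))"
      unfolding unmarked(4) using unmarked I by (intro mark_inv_admit) auto
  next
    case room
    show "mark_inv k (admit (make_room k (M, N, U, u) r) (r, b))"
      unfolding room(3) using room I by (intro mark_inv_admit) auto
  next
    case (discard q)
    have "card (N - {q}) < card N" using discard I by (intro card_Diff1_less)
    then show "mark_inv k (admit (make_room k (M, N, U, u) r) (r, b))"
      unfolding discard(3) using discard I by (intro mark_inv_admit) auto
  next
    case (stale v)
    show "mark_inv k (admit (make_room k (M, N, U, u) r) (r, b))"
      unfolding stale(5) using stale I by (intro mark_inv_admit) auto
  next
    case phase
    show "mark_inv k (admit (make_room k (M, N, U, u) r) (r, b))"
      unfolding phase(6) using phase I k by (intro mark_inv_admit) auto
  qed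
qed

lemma mark_inv_state: "k \<ge> 1 \<Longrightarrow> mark_inv k (mark_state k hs)"
  by (induction hs rule: rev_induct) (auto intro: mark_inv_step)

section \<open>The random cache that realizes a state\<close>

fun cache_dist :: "'a mark_state \<Rightarrow> 'a set pmf" where
  "cache_dist (M, N, U, u) = map_pmf (\<lambda>R. M \<union> N \<union> R) (pmf_of_set (usets U u))"

fun can_follow :: "nat \<Rightarrow> 'a mark_state \<Rightarrow> 'a \<Rightarrow> 'a set \<Rightarrow> bool" where
  "can_follow k (M, N, U, u) r C \<longleftrightarrow>
     r \<in> M \<union> N \<and> M \<union> N \<subseteq> insert r C \<and> finite (M \<union> N) \<and> finite U \<and>
     u \<le> card (C \<inter> U) \<and> card (M \<union> N) + u \<le> k"

text \<open>The unmarked part of the next cache is drawn from the pages of \<open>U\<close> that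
  \<open>C\<close> still holds, so that no unmarked page is ever loaded.\<close>

fun restrict_state :: "'a mark_state \<Rightarrow> 'a set \<Rightarrow> 'a mark_state" where
  "restrict_state (M, N, U, u) C = (M, N, C \<inter> U, u)"

text \<open>The fallback of loading only the requested page is for cache histories that the algorithm
  itself cannot produce.\<close>

definition mark_alg :: "nat \<Rightarrow> 'a online_alg" where
  "mark_alg k hs cs =
     (if can_follow k (mark_state k hs) (fst (last hs)) (cur cs)
      then cache_dist (restrict_state (mark_state k hs) (cur cs))
      else return_pmf {fst (last hs)})"

lemma set_cache_dist:
  "finite U \<Longrightarrow> u \<le> card U \<Longrightarrow> set_pmf (cache_dist (M, N, U, u)) = (\<lambda>R. M \<union> N \<union> R) ` usets U u"
  by (simp add: set_pmf_of_set finite_usets usets_nonempty)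

lemma finite_set_mark_alg: "finite (set_pmf (mark_alg k hs cs))"
  by (cases "mark_state k hs") (simp add: mark_alg_def finite_usets usets_nonempty)

lemma valid_mark_alg:
  assumes k: "k \<ge> 1"
  shows "valid_online_alg k (mark_alg k)"
  unfolding valid_online_alg_def
proof (intro allI ballI)
  fix hs :: "('a \<times> bool) list" and x cs C'
  assume C': "C' \<in> set_pmf (mark_alg k (hs @ [x]) cs)"
  obtain M N U u where st: "mark_state k (hs @ [x]) = (M, N, U, u)" by (metis prod_cases4)
  show "fst x \<in> C' \<and> C' \<subseteq> insert (fst x) (cur cs) \<and> finite C' \<and> card C' \<le> k"
  proof (cases "can_follow k (M, N, U, u) (fst x) (cur cs)")
    case True
    then have "C' \<in> set_pmf (cache_dist (M, N, cur cs \<inter> U, u))"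
      using C' unfolding mark_alg_def st by simp
    then obtain R where R: "C' = M \<union> N \<union> R" "R \<subseteq> cur cs \<inter> U" "card R = u"
      using True by (subst (asm) set_cache_dist) (auto simp: usets_def)
    moreover have "finite R" using R True by (auto intro: finite_subset)
    moreover have "card C' \<le> card (M \<union> N) + card R" using R card_Un_le by metis
    ultimately show ?thesis using True by auto
  next
    case False
    then have "C' = {fst x}" using C' unfolding mark_alg_def st by (simp del: can_follow.simps)
    then show ?thesis using k by simp
  qed
qed

text \<open>The disjuncts are the possible changes within a phase: nothing happens, a random
  unmarked page is evicted, the unmarked page \<open>r\<close> is requested, or \<open>U\<close> is
  forgotten. Redrawing from the surviving pages keeps the subset uniform in each case.\<close>

lemma bind_usets_shrink:
  assumes U: "finite U" "u \<le> card U"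
    and shrink: "U' = U \<and> u' = u \<or> U' = U \<and> u = Suc u' \<or> r \<in> U \<and> U' = U - {r} \<and> u = Suc u' \<or> U' = {} \<and> u' = 0"
  shows "bind_pmf (pmf_of_set (usets U u)) (\<lambda>R. pmf_of_set (usets (R \<inter> U') u')) = pmf_of_set (usets U' u')"
      (is ?eq)
    and "R \<in> usets U u \<Longrightarrow> u' \<le> card (R \<inter> U')"
proof -
  have S: "finite (usets U u)" "usets U u \<noteq> {}" using U by (auto simp: finite_usets usets_nonempty)
  have R: "finite R" "card R = u" "R \<subseteq> U" if "R \<in> usets U u" for R
    using that U finite_subset by (auto simp: usets_def)
  show "u' \<le> card (R \<inter> U')" if "R \<in> usets U u"
  proof -
    have "R \<inter> U = R" "R \<inter> (U - {r}) = R - {r}" using R[OF that] by auto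
    then show ?thesis using shrink R[OF that] by (auto simp: card_Diff_singleton_if)
  qed
  from shrink consider (same) "U' = U" "u' = u" | (drop) "U' = U" "u = Suc u'"
    | (remove) "r \<in> U" "U' = U - {r}" "u = Suc u'" | (clear) "U' = {}" "u' = 0" by blast
  then show ?eq
  proof cases
    case same
    have "bind_pmf (pmf_of_set (usets U u)) (\<lambda>R. pmf_of_set (usets (R \<inter> U') u'))
       = bind_pmf (pmf_of_set (usets U u)) return_pmf"
    proof (intro bind_pmf_cong refl)
      fix R assume "R \<in> set_pmf (pmf_of_set (usets U u))"
      then have R': "R \<in> usets U u" using S by simp
      have "R \<inter> U' = R" using R[OF R'] same by auto
      then have "usets (R \<inter> U') u' = {R}" using R[OF R'] usets_card[of R] same by simp
      then show "pmf_of_set (usets (R \<inter> U') u') = return_pmf R" by (simp add: pmf_of_set_singleton)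
    qed
    then show ?thesis using same by (simp add: bind_return_pmf')
  next
    case drop
    have "bind_pmf (pmf_of_set (usets U u)) (\<lambda>R. pmf_of_set (usets (R \<inter> U') u'))
       = bind_pmf (pmf_of_set (usets U (Suc u'))) (\<lambda>R. pmf_of_set (usets R u'))"
      using drop R S by (intro bind_pmf_cong) (auto simp: Int_absorb2)
    then show ?thesis using bind_usets_drop[of U u'] U drop by simp
  next
    case remove
    have "R \<inter> U' = R - {r}" if "R \<in> usets U u" for R using R[OF that] remove by auto
    then have "bind_pmf (pmf_of_set (usets U u)) (\<lambda>R. pmf_of_set (usets (R \<inter> U') u'))
       = bind_pmf (pmf_of_set (usets U (Suc u'))) (\<lambda>R. pmf_of_set (usets (R - {r}) u'))"
      using remove S by (intro bind_pmf_cong) auto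
    then show ?thesis using bind_usets_remove[of U r u'] U remove by simp
  next
    case clear
    then show ?thesis by (simp add: bind_pmf_const)
  qed
qed

text \<open>Averaged over the current cache, one step of the algorithm produces exactly the
  distribution attached to the next state. The second claim shows that the fallback of
  \<open>mark_alg\<close> is never taken on the way.\<close>

lemma mark_step_transition:
  assumes inv: "mark_inv k st" and k: "k \<ge> 1"
  shows "bind_pmf (cache_dist st) (\<lambda>C. cache_dist (restrict_state (mark_step k st (r, b)) C))
       = cache_dist (mark_step k st (r, b))" (is ?eq)
    and "C \<in> set_pmf (cache_dist st) \<Longrightarrow> can_follow k (mark_step k st (r, b)) r C"
proof -
  obtain M N U u where st: "st = (M, N, U, u)" by (metis prod_cases4)
  obtain M' N' U' u' where st': "mark_step k st (r, b) = (M', N', U', u')" by (metis prod_cases4)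
  have step: "mark_step k (M, N, U, u) (r, b) = admit (make_room k (M, N, U, u) r) (r, b)"
    by (simp add: mark_step_def)
  have I: "finite M" "finite N" "finite U" "M \<inter> N = {}" "(M \<union> N) \<inter> U = {}"
     "card M + card N + u \<le> k" "u \<le> card U" "u = 0 \<Longrightarrow> U = {}"
    using inv by (auto simp: st)
  have I': "finite M'" "finite N'" "finite U'" "M' \<inter> N' = {}" "(M' \<union> N') \<inter> U' = {}"
     "card M' + card N' + u' \<le> k" "u' \<le> card U'"
    using mark_inv_step[OF inv k, of "(r, b)"] by (auto simp: st')
  have req: "r \<in> M' \<union> N'" using st'
    by (cases "make_room k st r") (auto simp: mark_step_def split: if_splits)
  have cardMN': "card (M' \<union> N') + u' \<le> k" using I' by (simp add: card_Un_disjoint)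
  have sub: "M' \<union> N' \<subseteq> insert r (M \<union> N)"
    using st' unfolding st step
    by (cases rule: make_room_cases[OF inv[unfolded st], of r]) (auto split: if_splits)
  have S: "finite (usets U u)" "usets U u \<noteq> {}" using I by (auto simp: finite_usets usets_nonempty)
  have cd: "set_pmf (cache_dist st) = (\<lambda>R. M \<union> N \<union> R) ` usets U u"
    unfolding st using I by (intro set_cache_dist)
  have "?eq \<and> (\<forall>C \<in> set_pmf (cache_dist st). u' \<le> card (C \<inter> U'))"
  \<comment> \<open>The new unmarked pages meet the old \<open>M \<union> N\<close> only when a
    phase begins; the old cache is then deterministic and equal to \<open>U'\<close>. For
    \<open>k = 1\<close> a new phase leaves \<open>U'\<close> empty and belongs to the first
    case.\<close>
  proof (cases "(M \<union> N) \<inter> U' = {}")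
    case True
    have shrink: "U' = U \<and> u' = u \<or> U' = U \<and> u = Suc u' \<or> r \<in> U \<and> U' = U - {r} \<and> u = Suc u' \<or> U' = {} \<and> u' = 0"
      using st' True I(8) unfolding st step
      by (cases rule: make_room_cases[OF inv[unfolded st], of r]) (auto split: if_splits)
    have CU: "(M \<union> N \<union> R) \<inter> U' = R \<inter> U'" for R using True by auto
    have "bind_pmf (cache_dist st) (\<lambda>C. cache_dist (restrict_state (M', N', U', u') C))
       = map_pmf (\<lambda>R. M' \<union> N' \<union> R) (bind_pmf (pmf_of_set (usets U u)) (\<lambda>R. pmf_of_set (usets (R \<inter> U') u')))"
      by (simp add: st bind_map_pmf map_bind_pmf CU)
    also have "\<dots> = cache_dist (M', N', U', u')"
      using bind_usets_shrink(1)[OF I(3) I(7) shrink] by simp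
    finally have ?eq unfolding st' .
    moreover have "\<forall>C \<in> set_pmf (cache_dist st). u' \<le> card (C \<inter> U')"
      unfolding cd using bind_usets_shrink(2)[OF I(3) I(7) shrink] CU by auto
    ultimately show ?thesis by blast
  next
    case False
    have "N = {} \<and> u = 0 \<and> U = {} \<and> U' = M"
      using st' False I(5) unfolding st step
      by (cases rule: make_room_cases[OF inv[unfolded st], of r]) (auto split: if_splits)
    then have "cache_dist st = return_pmf U'" by (simp add: st usets_0 pmf_of_set_singleton)
    then show ?thesis using I' unfolding st' by (simp add: bind_return_pmf)
  qed
  then show ?eq and "C \<in> set_pmf (cache_dist st) \<Longrightarrow> can_follow k (mark_step k st (r, b)) r C"
    unfolding st' using req I' cardMN' sub cd by auto
qed

section \<open>Expected cost as a sum of miss probabilities\<close>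

fun miss_prob :: "'a mark_state \<Rightarrow> 'a \<Rightarrow> real" where
  "miss_prob (M, N, U, u) r = (if r \<in> M \<union> N then 0 else if r \<in> U then 1 - u / card U else 1)"

text \<open>Chance enters only for \<open>r\<close> in \<open>U\<close>: with
  \<open>n = card U\<close>, the \<open>u\<close>-subsets avoiding \<open>r\<close> make up the
  fraction \<open>((n - 1) choose u) / (n choose u) = 1 - u / n\<close>.\<close>

lemma measure_cache_dist_miss:
  assumes inv: "mark_inv k st"
  shows "measure_pmf.prob (cache_dist st) {C. r \<notin> C} = miss_prob st r"
proof -
  obtain M N U u where st: "st = (M, N, U, u)" by (metis prod_cases4)
  have I: "finite U" "(M \<union> N) \<inter> U = {}" "u \<le> card U"
    using inv by (auto simp: st)
  have S: "finite (usets U u)" "usets U u \<noteq> {}" using I by (auto simp: finite_usets usets_nonempty)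
  have *: "measure_pmf.prob (cache_dist st) {C. r \<notin> C}
     = card (usets U u \<inter> {R. r \<notin> M \<union> N \<union> R}) / card (usets U u)"
    using S by (simp add: st measure_pmf_of_set vimage_def)
  consider "r \<in> M \<union> N" | "r \<notin> M \<union> N" "r \<in> U" | "r \<notin> M \<union> N" "r \<notin> U" by blast
  then show ?thesis
  proof cases
    case 1
    then have "usets U u \<inter> {R. r \<notin> M \<union> N \<union> R} = {}" by auto
    then show ?thesis unfolding * using 1 by (simp add: st)
  next
    case 2
    then have sets: "usets U u \<inter> {R. r \<notin> M \<union> N \<union> R} = usets (U - {r}) u" by (auto simp: usets_def)
    have "(card U - u) * (card U choose u) = card U * ((card U - 1) choose u)"
      by (rule binomial_absorb_comp)
    then have "(real (card U) - u) * (card U choose u) = card U * real ((card U - 1) choose u)"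
      using I by (metis of_nat_mult of_nat_diff)
    moreover have "real (card U) > 0" "real (card U choose u) > 0" using 2 I by (auto simp: card_gt_0_iff)
    moreover have "b / a = 1 - v / n" if "(n - v) * a = n * b" "n > 0" "a > 0" for a b n v :: real
      using that by (simp add: divide_simps mult.commute)
    ultimately have "real ((card U - 1) choose u) / (card U choose u) = 1 - u / card U" by blast
    then show ?thesis unfolding * using 2 I sets by (simp add: st card_usets)
  next
    case 3
    then have "usets U u \<inter> {R. r \<notin> M \<union> N \<union> R} = usets U u" by (auto simp: usets_def)
    then show ?thesis unfolding * using 3 S by (simp add: st)
  qed
qed

lemma finite_set_run:
  assumes "\<And>hs cs. finite (set_pmf (A hs cs))"
  shows "finite (set_pmf (run A hs cs xs))"
  by (induction xs arbitrary: hs cs) (auto simp: assms)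

lemma expectation_run_Cons:
  assumes A: "\<And>hs cs. finite (set_pmf (A hs cs))"
  shows "measure_pmf.expectation (run A hs cs (x # xs)) real
    = indicator {cs. fst x \<notin> cur cs} cs
      + measure_pmf.expectation (A (hs @ [x]) cs)
          (\<lambda>C'. measure_pmf.expectation (run A (hs @ [x]) (cs @ [C']) xs) real)"
proof -
  have [simp]: "integrable (measure_pmf (run A hs cs xs)) f" for hs cs and f :: "nat \<Rightarrow> real"
    by (intro integrable_measure_pmf_finite finite_set_run A)
  have [simp]: "integrable (measure_pmf (A hs cs)) f" for hs cs and f :: "'a set \<Rightarrow> real"
    by (intro integrable_measure_pmf_finite A)
  show ?thesis
    by (simp add: expectation_bind_finite A finite_set_run)
qed

text \<open>Stated for any finitely supported law \<open>D\<close> of histories, because the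
  induction passes through random histories while the state stays deterministic. Only the law of the
  current cache matters.\<close>

lemma expectation_run_mark_alg:
  assumes k: "k \<ge> 1" and "finite (set_pmf D)" and "map_pmf cur D = cache_dist (mark_state k hs)"
  shows "measure_pmf.expectation D (\<lambda>cs. measure_pmf.expectation (run (mark_alg k) hs cs xs) real)
    = (\<Sum>i<length xs. miss_prob (mark_state k (hs @ take i xs)) (fst (xs ! i)))"
  using assms(2,3)
proof (induction xs arbitrary: D hs)
  case Nil
  then show ?case by simp
next
  case (Cons x xs)
  let ?A = "mark_alg k" and ?hs = "hs @ [x]" and ?st = "mark_state k hs"
  obtain r b where x: "x = (r, b)" by (cases x)
  have inv: "mark_inv k ?st" using k by (rule mark_inv_state)
  \<comment> \<open>The law of the histories after serving \<open>x\<close>, to which the induction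
    hypothesis is applied.\<close>
  define D' where "D' = bind_pmf D (\<lambda>cs. map_pmf (\<lambda>C'. cs @ [C']) (?A ?hs cs))"
  have A: "?A ?hs cs = cache_dist (restrict_state (mark_step k ?st x) (cur cs))" if "cs \<in> set_pmf D" for cs
  proof -
    have "cur cs \<in> set_pmf (cache_dist ?st)" using that Cons.prems(2)[symmetric] by auto
    then have "can_follow k (mark_step k ?st x) r (cur cs)"
      unfolding x by (rule mark_step_transition(2)[OF inv k])
    then show ?thesis by (simp add: mark_alg_def x)
  qed
  have "map_pmf cur D' = bind_pmf D (\<lambda>cs. ?A ?hs cs)"
    by (simp add: D'_def map_bind_pmf map_pmf_comp cur_def)
  also have "\<dots> = bind_pmf D (\<lambda>cs. cache_dist (restrict_state (mark_step k ?st x) (cur cs)))"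
    using A by (intro bind_pmf_cong) auto
  also have "\<dots> = bind_pmf (cache_dist ?st) (\<lambda>C. cache_dist (restrict_state (mark_step k ?st x) C))"
    by (simp add: Cons.prems(2)[symmetric] bind_map_pmf)
  also have "\<dots> = cache_dist (mark_state k ?hs)"
    unfolding x mark_state_snoc by (rule mark_step_transition(1)[OF inv k])
  finally have D': "map_pmf cur D' = cache_dist (mark_state k ?hs)" .
  have fD': "finite (set_pmf D')" using Cons.prems(1) by (simp add: D'_def finite_set_mark_alg)
  have "measure_pmf.expectation D (\<lambda>cs. measure_pmf.expectation (run ?A hs cs (x # xs)) real)
     = measure_pmf.expectation D (\<lambda>cs. indicator {cs. r \<notin> cur cs} cs +
         measure_pmf.expectation (map_pmf (\<lambda>C'. cs @ [C']) (?A ?hs cs))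
          (\<lambda>cs'. measure_pmf.expectation (run ?A ?hs cs' xs) real))"
    by (subst expectation_run_Cons[OF finite_set_mark_alg]) (simp add: x)
  also have "\<dots> = measure_pmf.prob D {cs. r \<notin> cur cs} +
      measure_pmf.expectation D' (\<lambda>cs'. measure_pmf.expectation (run ?A ?hs cs' xs) real)"
    using Cons.prems(1)
    by (simp add: D'_def expectation_bind_finite finite_set_mark_alg integrable_measure_pmf_finite)
  also have "measure_pmf.prob D {cs. r \<notin> cur cs} = measure_pmf.prob (map_pmf cur D) {C. r \<notin> C}"
    by (simp add: vimage_def)
  also have "\<dots> = miss_prob ?st r"
    unfolding Cons.prems(2) by (rule measure_cache_dist_miss[OF inv])
  also have "measure_pmf.expectation D' (\<lambda>cs'. measure_pmf.expectation (run ?A ?hs cs' xs) real)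
     = (\<Sum>i<length xs. miss_prob (mark_state k (?hs @ take i xs)) (fst (xs ! i)))"
    using fD' D' by (rule Cons.IH)
  finally show ?case by (simp add: sum.lessThan_Suc_shift x del: sum.lessThan_Suc mark_state_snoc)
qed

lemma expected_cost_mark_alg:
  assumes k: "k \<ge> 1" and len: "length p = length I"
  shows "expected_cost (mark_alg k) I p
    = (\<Sum>i<length I. miss_prob (mark_state k (zip (take i I) (take i p))) (I ! i))"
  using expectation_run_mark_alg[OF k, of "return_pmf []" "[]" "zip I p"] len
  by (simp add: expected_cost_def cur_def usets_0 pmf_of_set_singleton take_zip)

section \<open>The amortized analysis\<close>

abbreviation (input) harmonic :: "nat \<Rightarrow> real" where "harmonic m \<equiv> (\<Sum>j = 1..m. 1 / real j)"

lemma harmonic_mono: "m \<le> n \<Longrightarrow> harmonic m \<le> harmonic n"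
  by (intro sum_mono2) auto

lemma harmonic_ge_1: "m \<ge> 1 \<Longrightarrow> harmonic m \<ge> 1"
  using harmonic_mono[of 1 m] by simp

lemma harmonic_nonneg: "harmonic m \<ge> 0"
  by (intro sum_nonneg) auto

section \<open>Latest requests and wrong predictions\<close>

definition last_at :: "'a list \<Rightarrow> nat \<Rightarrow> 'a \<Rightarrow> nat \<Rightarrow> bool" where
  "last_at I t q i \<longleftrightarrow> i < t \<and> I ! i = q \<and> (\<forall>j. i < j \<and> j < t \<longrightarrow> I ! j \<noteq> q)"

lemma last_at_exists:
  assumes "i < t" "I ! i = q"
  obtains j where "last_at I t q j"
proof -
  let ?X = "{i. i < t \<and> I ! i = q}"
  have "finite ?X" "?X \<noteq> {}" using assms by auto
  then have "Max ?X \<in> ?X" "\<forall>j\<in>?X. j \<le> Max ?X" using Max_in[of ?X] Max_ge[of ?X] by blast+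
  then have "last_at I t q (Max ?X)" unfolding last_at_def by (metis (mono_tags, lifting) mem_Collect_eq not_less)
  then show thesis by (rule that)
qed

lemma last_at_Suc: "last_at I (Suc t) q i \<longleftrightarrow> (if q = I ! t then i = t else last_at I t q i)"
  unfolding last_at_def by (auto simp: less_Suc_eq)

locale predictions = lfd tb k I for tb :: "'a set \<Rightarrow> 'a" and k :: nat and I :: "'a list" +
  fixes p :: "bool list"
  assumes len: "length p = length I"
begin

abbreviation bad :: "nat \<Rightarrow> bool" where "bad \<equiv> truth tb k I"

text \<open>The next request after \<open>i\<close> is the one at \<open>t\<close>. LFD loads only
  requested pages, so a page dropped in between is still missing at \<open>t\<close>.\<close>

lemma bad_imp_fault:
  assumes t: "t < length I" and last: "last_at I t (I ! t) i" and bad: "bad i"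
  shows "I ! t \<notin> L t"
proof -
  have i: "i < t" "I ! i = I ! t" "\<And>j. i < j \<Longrightarrow> j < t \<Longrightarrow> I ! j \<noteq> I ! t"
    using last by (auto simp: last_at_def)
  obtain m where m: "next_req I i (I ! i) = Some m" "i < m" "m \<le> t" "I ! m = I ! i"
    using next_req_SomeI[of i t I "I ! i"] i t by metis
  then have "m = t" using i by (metis le_neq_implies_less)
  then obtain j where j: "i < j" "j \<le> t" "I ! t \<notin> L j" using bad m i by (auto simp: truth_def)
  have "I ! t \<notin> L j'" if "j \<le> j'" "j' \<le> t" for j'
    using that
  proof (induction j' rule: dec_induct)
    case (step j')
    then show ?case using i(3)[of j'] j L_mono_notin[of "I ! t" j'] by auto
  qed (rule j)
  then show ?thesis using j by simp
qed

text \<open>Request \<open>t\<close> is not to \<open>q\<close>, so the next request to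
  \<open>q\<close>, if any, comes after \<open>t\<close>, and \<open>Suc t\<close> lies in the
  window inspected by \<open>truth\<close>.\<close>

lemma bad_if_evicted:
  assumes t: "t < length I" and last: "last_at I t q i" and q: "q \<noteq> I ! t" "q \<notin> L (Suc t)"
  shows "bad i"
proof -
  have "Suc t \<le> (case next_req I i (I ! i) of Some j \<Rightarrow> j | None \<Rightarrow> length I)"
  proof (cases "next_req I i (I ! i)")
    case (Some j)
    then have "i < j" "I ! j = I ! i" using next_req_SomeD[of I i "I ! i" j] by auto
    then have "\<not> j < t" "j \<noteq> t" using last q by (auto simp: last_at_def)
    then show ?thesis using Some by simp
  qed (use t in auto)
  then show ?thesis using last q unfolding truth_def Let_def last_at_def
    by (intro exI[of _ "Suc t"]) auto
qed

lemma L_requested_before: "q \<in> L t \<Longrightarrow> \<exists>i<t. I ! i = q"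
proof (induction t)
  case (Suc t)
  then show ?case using L_mono_notin[of q t] by (metis less_Suc_eq)
qed simp

definition errors0 :: "nat \<Rightarrow> nat" where
  "errors0 t = card {i. i < t \<and> \<not> p ! i \<and> bad i}"

lemma errors0_mono: "s \<le> t \<Longrightarrow> errors0 s \<le> errors0 t"
  unfolding errors0_def by (intro card_mono) auto

lemma errors0_length: "errors0 (length I) = eta0 tb k I p"
  by (simp add: errors0_def eta0_def)

text \<open>Counts the faults that are charged to a wrong prediction 1 of the previous request to the page.\<close>

definition paid :: "nat \<Rightarrow> nat" where
  "paid t = card {j. j < t \<and> (\<exists>i. last_at I j (I ! j) i \<and> p ! i \<and> \<not> bad i)}"

lemma paid_Suc:
  "paid (Suc t) = paid t + (if \<exists>i. last_at I t (I ! t) i \<and> p ! i \<and> \<not> bad i then 1 else 0)"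
proof -
  let ?P = "\<lambda>j. \<exists>i. last_at I j (I ! j) i \<and> p ! i \<and> \<not> bad i"
  have "{j. j < Suc t \<and> ?P j} = {j. j < t \<and> ?P j} \<union> (if ?P t then {t} else {})"
    by (auto simp: less_Suc_eq)
  then show ?thesis by (auto simp: paid_def)
qed

text \<open>Each counted time is mapped to the preceding request of its page. Two times cannot share
  it, since the earlier one would lie between it and the later one.\<close>

lemma paid_le_eta1: "paid (length I) \<le> eta1 tb k I p"
proof -
  let ?P = "\<lambda>j i. last_at I j (I ! j) i \<and> p ! i \<and> \<not> bad i"
  let ?X = "{j. j < length I \<and> (\<exists>i. ?P j i)}"
  define f where "f j = (SOME i. ?P j i)" for j
  have f: "?P j (f j)" if "j \<in> ?X" for j
    using that someI_ex[of "?P j"] unfolding f_def by blast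
  have "inj_on f ?X"
  proof (rule inj_onI)
    fix j j' assume j: "j \<in> ?X" "j' \<in> ?X" "f j = f j'"
    have "last_at I j (I ! j) (f j)" "last_at I j' (I ! j') (f j)" using f[OF j(1)] f[OF j(2)] j(3) by auto
    then show "j = j'" unfolding last_at_def by (metis linorder_neqE_nat)
  qed
  moreover have "f ` ?X \<subseteq> {i. i < length I \<and> p ! i \<and> \<not> bad i}"
  proof
    fix i assume "i \<in> f ` ?X"
    then obtain j where j: "j \<in> ?X" "i = f j" by blast
    then have "last_at I j (I ! j) i" "p ! i" "\<not> bad i" using f[OF j(1)] by auto
    then show "i \<in> {i. i < length I \<and> p ! i \<and> \<not> bad i}" using j(1) by (simp add: last_at_def)
  qed
  ultimately show ?thesis unfolding paid_def eta1_def
    by (rule card_inj_on_le) simp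
qed

text \<open>The bound \<open>s\<close>, later the start of a phase, makes the wrong predictions
  found by \<open>errors_ge\<close> count towards the growth of \<open>errors0\<close> since
  \<open>s\<close>.\<close>

definition tracked :: "nat \<Rightarrow> nat \<Rightarrow> 'a set \<Rightarrow> bool" where
  "tracked t s X \<longleftrightarrow> (\<forall>q\<in>X. \<exists>i\<ge>s. last_at I t q i \<and> \<not> p ! i)"

lemma tracked_insert:
  "tracked t s (insert q X) \<longleftrightarrow> (\<exists>i\<ge>s. last_at I t q i \<and> \<not> p ! i) \<and> tracked t s X"
  by (simp add: tracked_def)

lemma tracked_mono: "tracked t s X \<Longrightarrow> s' \<le> s \<Longrightarrow> tracked t s' X"
  unfolding tracked_def by (meson order_trans)

lemma tracked_Suc: "I ! t \<notin> X \<Longrightarrow> tracked (Suc t) s X \<longleftrightarrow> tracked t s X"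
  unfolding tracked_def by (intro ball_cong) (auto simp: last_at_Suc)

text \<open>LFD cannot hold the requested page together with \<open>k\<close> others, so every page of \<open>Q\<close> in excess
  of \<open>k - 1\<close> carries a wrong prediction 0.\<close>

lemma errors_ge:
  assumes t: "t < length I" and st: "s \<le> t" and Q: "finite Q" "I ! t \<notin> Q" "tracked t s Q"
  shows "errors0 s + card Q + 1 \<le> errors0 (Suc t) + k"
proof -
  define f where "f q = (SOME i. i \<ge> s \<and> last_at I t q i \<and> \<not> p ! i)" for q
  have f: "f q \<ge> s \<and> last_at I t q (f q) \<and> \<not> p ! f q" if "q \<in> Q" for q
  proof -
    have "\<exists>i. i \<ge> s \<and> last_at I t q i \<and> \<not> p ! i" using that Q(3) by (auto simp: tracked_def)
    then show ?thesis unfolding f_def by (rule someI_ex)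
  qed
  let ?X = "Q - L (Suc t)" and ?Y = "{i. s \<le> i \<and> i < Suc t \<and> \<not> p ! i \<and> bad i}"
  \<comment> \<open>Pages of \<open>Q\<close> missing from LFD's cache are charged to their latest
    requests; a position requests only one page.\<close>
  have "inj_on f ?X"
    using f by (intro inj_onI) (metis DiffD1 last_at_def)
  moreover have "f ` ?X \<subseteq> ?Y"
  proof
    fix i assume "i \<in> f ` ?X"
    then obtain q where q: "q \<in> Q" "q \<notin> L (Suc t)" "i = f q" by auto
    then have "bad i" using f[OF q(1)] Q(2) bad_if_evicted[OF t, of q i] by metis
    then show "i \<in> ?Y" using f[OF q(1)] q by (auto simp: last_at_def)
  qed
  ultimately have X: "card ?X \<le> card ?Y" by (intro card_inj_on_le[of f]) auto
  have fin: "finite (L (Suc t))" "card (L (Suc t)) \<le> k" using L_finite_card by auto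
  have "card (Q \<inter> L (Suc t)) < card (L (Suc t))"
    using fin L_requested[of t] Q(2) by (intro psubset_card_mono) auto
  moreover have "card Q = card (Q \<inter> L (Suc t)) + card ?X"
    using Q(1) by (metis card_Int_Diff)
  moreover have "errors0 (Suc t) = errors0 s + card ?Y"
  proof -
    let ?Z = "{i. i < s \<and> \<not> p ! i \<and> bad i}"
    have "{i. i < Suc t \<and> \<not> p ! i \<and> bad i} = ?Z \<union> ?Y" using st by auto
    moreover have "card (?Z \<union> ?Y) = card ?Z + card ?Y" by (rule card_Un_disjoint) auto
    ultimately show ?thesis unfolding errors0_def by simp
  qed
  ultimately show ?thesis using X fin by linarith
qed

text \<open>A fault outside \<open>M \<union> U\<close> is paid from one of three sources: the
  prepaid unit of a page in \<open>T\<close>, a simultaneous fault of LFD, or, if LFD hits, a wrong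
  prediction 1 at the latest request to the page.\<close>

lemma miss_payment:
  assumes t: "t < length I" and T: "finite T"
    and known: "\<And>i. last_at I t (I ! t) i \<Longrightarrow> \<not> p ! i \<Longrightarrow> I ! t \<in> T"
  shows "1 + card (T - {I ! t}) + faults_before I L t + paid t
    \<le> card T + faults_before I L (Suc t) + paid (Suc t)"
proof (cases "I ! t \<in> T")
  case True
  then have "card T = Suc (card (T - {I ! t}))" using T by (metis card.remove)
  then show ?thesis by (simp add: paid_Suc)
next
  case False
  show ?thesis
  proof (cases "I ! t \<in> L t")
    case True
    then obtain i where i: "last_at I t (I ! t) i"
      using L_requested_before last_at_exists by metis
    then have "\<not> bad i" "p ! i" using bad_imp_fault[OF t i] True known[OF i] False by auto
    then show ?thesis using i False by (auto simp: paid_Suc)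
  qed (use False in \<open>simp add: paid_Suc\<close>)
qed

section \<open>The ledger along a run\<close>

definition st :: "nat \<Rightarrow> 'a mark_state" where
  "st t = mark_state k (zip (take t I) (take t p))"

lemma st_Suc: "t < length I \<Longrightarrow> st (Suc t) = mark_step k (st t) (I ! t, p ! t)"
  using len by (simp add: st_def take_Suc_conv_app_nth)

lemma st_inv: "mark_inv k (st t)"
  unfolding st_def using k_pos by (rule mark_inv_state)

text \<open>\<open>K\<close> counts the evictions of pages of \<open>U\<close> that were forced because no page with prediction 1
  was cached, \<open>T\<close> contains the pages with latest prediction 0 that were forgotten (one prepaid fault
  each), and \<open>s\<close>, \<open>s'\<close> are the starting times of the current and the previous phase.
  The potential \<open>(card U - u) * harmonic (card U)\<close> pays for the expected faults on pages of \<open>U\<close>,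
  and for their prepayment when they are forgotten.
  Every wrong prediction 0 accounts for at most one unit of \<open>K\<close> in each of two consecutive phases.\<close>

fun ledger :: "nat \<Rightarrow> real \<Rightarrow> 'a mark_state \<Rightarrow> 'a set \<Rightarrow> nat \<Rightarrow> nat \<Rightarrow> nat \<Rightarrow> bool" where
  "ledger t c (M, N, U, u) T K s s' \<longleftrightarrow>
     finite T \<and> s' \<le> s \<and> s \<le> t \<and>
     c + (card U - u) * harmonic (card U) + card T \<le> faults_before I L t + paid t + harmonic k * K \<and>
     K \<le> errors0 s + errors0 t \<and> (U \<noteq> {} \<longrightarrow> K + u \<le> errors0 s + errors0 s' + card U) \<and>
     tracked t s M \<and> tracked t s' U \<and>
     (\<forall>q i. last_at I t q i \<and> \<not> p ! i \<longrightarrow> q \<in> M \<union> U \<union> T)"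

text \<open>The common end of all cases of \<open>ledger_step\<close>: the request is filed under
  its prediction, and if \<open>u = 0\<close> the pages of \<open>U\<close> move into
  \<open>T\<close>.\<close>

lemma ledger_admit:
  assumes u: "u \<le> card U" and U: "finite U" and r: "I ! t \<notin> M \<union> U"
    and T: "finite T" and s: "s' \<le> s" "s \<le> t"
    and cost: "c + (card U - u) * harmonic (card U) + card T
      \<le> faults_before I L (Suc t) + paid (Suc t) + harmonic k * K"
    and K: "K \<le> errors0 s + errors0 (Suc t)" "U \<noteq> {} \<Longrightarrow> K + u \<le> errors0 s + errors0 s' + card U"
    and tr: "tracked t s M" "tracked t s' U"
    and known: "\<And>q i. last_at I t q i \<Longrightarrow> \<not> p ! i \<Longrightarrow> q \<noteq> I ! t \<Longrightarrow> q \<in> M \<union> U \<union> T"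
  shows "\<exists>T K s s'. ledger (Suc t) c (admit (M, N, U, u) (I ! t, p ! t)) T K s s'"
proof -
  have tr': "tracked (Suc t) s (if p ! t then M else insert (I ! t) M)" "tracked (Suc t) s' U"
    using tr r s by (auto simp: tracked_insert tracked_Suc last_at_Suc)
  show ?thesis
  proof (cases "u = 0")
    case False
    then have "ledger (Suc t) c (admit (M, N, U, u) (I ! t, p ! t)) T K s s'"
      using assms tr' by (auto simp: last_at_Suc split: if_splits)
    then show ?thesis by blast
  next
    case True
    have "card (T \<union> U) \<le> card T + card U" by (rule card_Un_le)
    \<comment> \<open>At \<open>u = 0\<close> the potential is worth at least one unit per forgotten
      page, which is the prepayment that \<open>T\<close> requires.\<close>
    moreover have "real (card U) \<le> card U * harmonic (card U)"
      using harmonic_ge_1[of "card U"] by (cases "card U") (auto simp: mult_le_cancel_left1)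
    ultimately have "c + card (T \<union> U) \<le> faults_before I L (Suc t) + paid (Suc t) + harmonic k * K"
      using cost True by simp
    then have "ledger (Suc t) c (admit (M, N, U, u) (I ! t, p ! t)) (T \<union> U) K s s'"
      using assms tr' True by (auto simp: last_at_Suc tracked_def[of _ _ "{}"] split: if_splits)
    then show ?thesis by blast
  qed
qed

text \<open>A hit is free, a request to \<open>U\<close> is paid by the potential, and every other
  fault by \<open>miss_payment\<close>. Only \<open>stale\<close> and \<open>phase\<close> raise the
  potential, and they pay for it by increasing \<open>K\<close>.\<close>

lemma ledger_step:
  assumes t: "t < length I" and led: "ledger t c (st t) T K s s'"
  shows "\<exists>T K s s'. ledger (Suc t) (c + miss_prob (st t) (I ! t)) (st (Suc t)) T K s s'"
proof -
  let ?r = "I ! t" and ?F = "faults_before I L"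
  obtain M N U u where S: "st t = (M, N, U, u)" by (metis prod_cases4)
  have S': "st (Suc t) = admit (make_room k (M, N, U, u) ?r) (?r, p ! t)"
    using t by (simp add: st_Suc S mark_step_def)
  have inv: "mark_inv k (M, N, U, u)" using st_inv[of t] S by simp
  then have I: "finite M" "finite U" "M \<inter> N = {}" "(M \<union> N) \<inter> U = {}" "u \<le> card U" "card U \<le> k"
    by auto
  from led have T: "finite T" and s: "s' \<le> s" "s \<le> t"
    and cost: "c + (card U - u) * harmonic (card U) + card T \<le> ?F t + paid t + harmonic k * K"
    and K: "K \<le> errors0 s + errors0 t" "U \<noteq> {} \<Longrightarrow> K + u \<le> errors0 s + errors0 s' + card U"
    and tr: "tracked t s M" "tracked t s' U"
    and known: "\<And>q i. last_at I t q i \<Longrightarrow> \<not> p ! i \<Longrightarrow> q \<in> M \<union> U \<union> T"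
    unfolding S by auto
  have mono: "?F t + paid t \<le> ?F (Suc t) + paid (Suc t)" by (simp add: paid_Suc)
  have ES: "errors0 t \<le> errors0 (Suc t)" by (intro errors0_mono) simp
  have pay: "1 + real (card (T - {?r})) + ?F t + paid t \<le> card T + ?F (Suc t) + paid (Suc t)"
    if "?r \<notin> M \<union> U"
    using miss_payment[OF t T] known that by (metis UnE of_nat_add of_nat_le_iff of_nat_1)
  have tr_sub: "tracked t' s X" if "tracked t' s Y" "X \<subseteq> Y" for t' s X Y
    using that by (auto simp: tracked_def)
  from inv show ?thesis
  proof (cases rule: make_room_cases[where r = ?r])
    case hit
    have m: "miss_prob (st t) ?r = 0" using hit by (simp add: S)
    show ?thesis unfolding S' hit(2) m
      by (rule ledger_admit[where T = T and K = K and s = s and s' = s'])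
        (use hit I T s cost K tr known mono ES in \<open>auto intro: tr_sub\<close>)
  next
    case (unmarked v)
    obtain n where n: "card U = Suc n" using unmarked(1) I(2) by (cases "card U") auto
    have n': "card (U - {?r}) = n" using n unmarked(1) I(2) by simp
    have "miss_prob (st t) ?r = 1 - u / card U" using unmarked by (simp add: S)
    also have "\<dots> = (n - v) / Suc n" using I(5) unmarked(3) n by (simp add: field_simps of_nat_diff)
    \<comment> \<open>The miss probability \<open>(n - v) / Suc n\<close> is exactly the drop in
      potential when the harmonic factor goes from \<open>Suc n\<close> to \<open>n\<close>.\<close>
    finally have "miss_prob (st t) ?r + (n - v) * harmonic n = (n - v) * harmonic (Suc n)"
      by (simp add: field_simps)
    then have c: "c + miss_prob (st t) ?r + real (card (U - {?r}) - v) * harmonic (card (U - {?r})) + card T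
        \<le> ?F (Suc t) + paid (Suc t) + harmonic k * K"
      using cost mono n n' unmarked(3) by simp
    show ?thesis unfolding S' unmarked(4)
      by (rule ledger_admit[where T = T and K = K and s = s and s' = s', OF _ _ _ _ _ _ c])
        (use unmarked I T s K tr known ES n n' in \<open>auto intro: tr_sub\<close>)
  next
    case room
    have m: "miss_prob (st t) ?r = 1" using room by (simp add: S)
    have c: "c + 1 + real (card U - u) * harmonic (card U) + card (T - {?r})
        \<le> ?F (Suc t) + paid (Suc t) + harmonic k * K"
      using cost pay room(1) by simp
    show ?thesis unfolding S' room(3) m
      by (rule ledger_admit[where T = "T - {?r}" and K = K and s = s and s' = s', OF _ _ _ _ _ _ c])
        (use room I T s K tr known ES in auto)
  next
    case (discard q)
    have m: "miss_prob (st t) ?r = 1" using discard by (simp add: S)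
    have c: "c + 1 + real (card U - u) * harmonic (card U) + card (T - {?r})
        \<le> ?F (Suc t) + paid (Suc t) + harmonic k * K"
      using cost pay discard(1) by simp
    show ?thesis unfolding S' discard(3) m
      by (rule ledger_admit[where T = "T - {?r}" and K = K and s = s and s' = s', OF _ _ _ _ _ _ c])
        (use discard I T s K tr known ES in auto)
  next
    case (stale v)
    have m: "miss_prob (st t) ?r = 1" using stale by (simp add: S)
    have uU: "card U - v = Suc (card U - u)" using I(5) stale(3) by simp
    have Une: "U \<noteq> {}" using I(5) stale(3) by auto
    \<comment> \<open>The eviction raises the potential by \<open>harmonic (card U)\<close>, at most
      the \<open>harmonic k\<close> that one more unit of \<open>K\<close> provides.\<close>
    have "real (card U - v) * harmonic (card U) = real (card U - u) * harmonic (card U) + harmonic (card U)"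
      unfolding uU by (simp add: algebra_simps)
    then have c: "c + 1 + real (card U - v) * harmonic (card U) + card (T - {?r})
        \<le> ?F (Suc t) + paid (Suc t) + harmonic k * Suc K"
      using cost pay stale(1) harmonic_mono[OF I(6)] by (simp add: algebra_simps)
    have "tracked t s' (M \<union> U)" using tr(2) tracked_mono[OF tr(1) s(1)] by (auto simp: tracked_def)
    then have "errors0 s' + card (M \<union> U) + 1 \<le> errors0 (Suc t) + k"
      using stale(1) I s by (intro errors_ge t) auto
    moreover have "card (M \<union> U) = card M + card U" using I by (intro card_Un_disjoint) auto
    \<comment> \<open>Since \<open>card M + u = k\<close>, the pages \<open>M \<union> U\<close>
      reveal at least \<open>card U - u + 1\<close> errors since \<open>s'\<close>, which exceeds
      the slack in the bound on \<open>K + u\<close> by one.\<close>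
    ultimately have K': "Suc K \<le> errors0 s + errors0 (Suc t)"
      using K(2)[OF Une] stale(3,4) I(5) by linarith
    show ?thesis unfolding S' stale(5) m
      by (rule ledger_admit[where T = "T - {?r}" and K = "Suc K" and s = s and s' = s', OF _ _ _ _ _ _ c K'])
        (use stale I T s K tr known in auto)
  next
    case phase
    have m: "miss_prob (st t) ?r = 1" using phase by (simp add: S)
    have k1: "card M - (k - 1) = 1" using phase k_pos by simp
    \<comment> \<open>The new phase has \<open>k\<close> unmarked pages, one of them uncached, hence
      potential \<open>harmonic k\<close>, covered by the new unit of \<open>K\<close>.\<close>
    have c: "c + 1 + real (card M - (k - 1)) * harmonic (card M) + card (T - {?r})
        \<le> ?F (Suc t) + paid (Suc t) + harmonic k * Suc K"
      unfolding k1 using cost pay phase by (simp add: algebra_simps)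
    have "errors0 s + card M + 1 \<le> errors0 (Suc t) + k"
      using phase(1) I s tr by (intro errors_ge t) auto
    \<comment> \<open>\<open>M\<close> and the request are \<open>k + 1\<close> pages, so some
      prediction 0 since \<open>s\<close> was wrong. The new phase starts at \<open>t\<close> and
      not at \<open>Suc t\<close>, because request \<open>t\<close> is its first.\<close>
    then have K': "Suc K \<le> errors0 t + errors0 (Suc t)" "Suc K + (k - 1) \<le> errors0 t + errors0 s + card M"
      using K(1) phase(5) k_pos by linarith+
    show ?thesis unfolding S' phase(6) m
      by (rule ledger_admit[where T = "T - {?r}" and K = "Suc K" and s = t and s' = s, OF _ _ _ _ _ _ c K'])
        (use phase I T s tr known k_pos in \<open>auto simp: tracked_def[of _ _ "{}"]\<close>)
  qed
qed

lemma ledger_exists: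
  "t \<le> length I \<Longrightarrow> \<exists>T K s s'. ledger t (\<Sum>i<t. miss_prob (st i) (I ! i)) (st t) T K s s'"
proof (induction t)
  case 0
  have "ledger 0 0 (st 0) {} 0 0 0"
    by (simp add: st_def tracked_def last_at_def)
  then show ?case by auto
next
  case (Suc t)
  then show ?case using ledger_step[of t] by auto
qed

lemma expected_cost_bound:
  "expected_cost (mark_alg k) I p
    \<le> OPT k I + 2 * harmonic k * eta0 tb k I p + eta1 tb k I p"
proof -
  let ?n = "length I"
  obtain T K s s' where led: "ledger ?n (\<Sum>i<?n. miss_prob (st i) (I ! i)) (st ?n) T K s s'"
    using ledger_exists by blast
  obtain M N U u where S: "st ?n = (M, N, U, u)" by (metis prod_cases4)
  have "real (card U - u) * harmonic (card U) \<ge> 0" by (intro mult_nonneg_nonneg harmonic_nonneg) simp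
  then have c: "(\<Sum>i<?n. miss_prob (st i) (I ! i)) \<le> faults_before I L ?n + paid ?n + harmonic k * K"
    and K: "K \<le> errors0 s + errors0 ?n" "s \<le> ?n"
    using led unfolding S by auto
  \<comment> \<open>Both \<open>errors0\<close> terms are at most the final error count; this yields
    the factor 2.\<close>
  have "K \<le> 2 * eta0 tb k I p" using K errors0_mono[of s ?n] errors0_length by simp
  then have "real K \<le> 2 * real (eta0 tb k I p)" by linarith
  then have "harmonic k * K \<le> harmonic k * (2 * real (eta0 tb k I p))" by (intro mult_left_mono harmonic_nonneg)
  then show ?thesis
    using c lfd_le_OPT paid_le_eta1 expected_cost_mark_alg[OF k_pos len] by (simp add: st_def)
qed

end

theorem theorem2:
  fixes tb :: "'a set \<Rightarrow> 'a" and k :: nat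
  assumes tie_rule: "\<forall>S. S \<noteq> {} \<longrightarrow> tb S \<in> S"
    and k_pos: "k \<ge> 1"
  shows "\<exists>A :: 'a online_alg. valid_online_alg k A \<and>
           (\<exists>b :: real. \<forall>(I :: 'a list) (p :: bool list). length p = length I \<longrightarrow>
              expected_cost A I p
                \<le> real (OPT k I) + 2 * (\<Sum>j = 1..k. 1 / real j) * real (eta0 tb k I p)
                   + real (eta1 tb k I p) + b)"
proof (intro exI[of _ "mark_alg k"] conjI exI[of _ "0 :: real"] allI impI)
  show "valid_online_alg k (mark_alg k)" using k_pos by (rule valid_mark_alg)
next
  fix I :: "'a list" and p :: "bool list"
  assume "length p = length I"
  then interpret predictions tb k I p
    using tie_rule k_pos by unfold_locales auto
  \<comment> \<open>The additive constant is 0, as every entry of the ledger is zero at the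
    start.\<close>
  show "expected_cost (mark_alg k) I p
      \<le> real (OPT k I) + 2 * harmonic k * real (eta0 tb k I p) + real (eta1 tb k I p) + 0"
    using expected_cost_bound by simp
qed

end
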